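(* Let $X,Z$ be real locally convex Hausdorff topological vector spaces, $S\subset Z$ a nonempty closed convex cone, $\mathcal U$ a nonempty set, and for each $u\in\mathcal U$ let $G_u:X\to Z\cup\{+\infty_Z\}$ be a proper, $S$-convex and $S$-epi closed mapping. Assume that $\mathcal F:=\{x\in X: G_u(x)\in -S\ \ \forall u\in\mathcal U\}\neq\emptyset$. For $c\in X^*$ consider $$({\rm RP}_c)\quad \inf\{\langle c,x\rangle : x\in X,\ G_u(x)\in -S\ \forall u\in\mathcal U\},$$ $$({\rm RD}_c)\quad \sup_{(u,\lambda)\in\mathcal U\times S^+}\ \inf_{x\in X}\big(\langle c,x\rangle+(\lambda G_u)(x)\big),$$ and let $$\mathcal M_0:=\bigcup_{(u,\lambda)\in\mathcal U\times S^+}\operatorname{epi}(\lambda G_u)^*\subset X^*\times\mathbb R .$$ Assume that $r_0:=\inf({\rm RP}_c)>-\infty$. Then the following statements are equivalent: (a) $\mathcal M_0$ is a closed and convex subset of $X^*\times\mathbb R$; (b) the stable robust strong duality holds for the pair $({\rm RP}_c)-({\rm RD}_c)$, i.e. $$\inf({\rm RP}_c)=\max({\rm RD}_c)\quad\text{for all } c\in X^*.$$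
   Context: $X^*$ is the topological dual of $X$ with the weak* topology; $X^*\times\mathbb R$ has the product topology. $S^+:=\{z^*\in Z^*:\langle z^*,s\rangle\ge 0\ \forall s\in S\}$. $+\infty_Z$ is an added greatest element of $Z$ (not in $Z$). For $G:X\to Z\cup\{+\infty_Z\}$: $\operatorname{dom}G=\{x:G(x)\ne+\infty_Z\}$; $G$ is proper if $\operatorname{dom}G\neq\emptyset$; $\operatorname{epi}_SG=\{(x,z)\in X\times Z: x\in\operatorname{dom}G,\ z\in G(x)+S\}$; $G$ is $S$-convex (resp. $S$-epi closed) if $\operatorname{epi}_SG$ is convex (resp. closed in $X\times Z$). For $\lambda\in S^+$, $(\lambda G)(x)=\langle\lambda,G(x)\rangle$ if $x\in\operatorname{dom}G$ and $(\lambda G)(x)=+\infty$ otherwise. For $f:X\to\mathbb R\cup\{\pm\infty\}$, $f^*(x^* )=\sup_{x\in X}[\langle x^*,x\rangle-f(x)]$ and $\operatorname{epi}f^*=\{(x^*,r)\in X^*\times\mathbb R: f^*(x^* )\le r\}$. "$\inf({\rm RP}_c)=\max({\rm RD}_c)$" means that the optimal values are equal and the supremum over $(u,\lambda)\in\mathcal U\times S^+$ in $({\rm RD}_c)$ is attained. *)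

theory Defs
  imports "HOL-Analysis.Analysis"
begin

class real_topological_vector_space = real_vector + topological_ab_group_add +
  assumes tendsto_scaleR_nhds_Pair:
    "LIM p (nhds r \<times>\<^sub>F nhds x). fst p *\<^sub>R snd p :> nhds (r *\<^sub>R x)"

class locally_convex_t2_space = real_topological_vector_space + t2_space +
  assumes locally_convex_at_0:
    "open W \<Longrightarrow> 0 \<in> W \<Longrightarrow> \<exists>V. open V \<and>
      (\<forall>x\<in>V. \<forall>y\<in>V. \<forall>a\<ge>0. \<forall>b\<ge>0. a + b = 1 \<longrightarrow> a *\<^sub>R x + b *\<^sub>R y \<in> V) \<and> 0 \<in> V \<and> V \<subseteq> W"

text \<open>The unfolded convexity is due to \<^const>\<open>convex\<close> not being usable in a class specification.\<close>

lemma locally_convex_at_0':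
  fixes W :: "'a::locally_convex_t2_space set"
  assumes "open W" "0 \<in> W"
  shows "\<exists>V. open V \<and> convex V \<and> 0 \<in> V \<and> V \<subseteq> W"
  using locally_convex_at_0[OF assms] unfolding convex_def by simp


section \<open>Topological dual with the weak* topology\<close>

typedef (overloaded) 'a dual =
  "{f :: 'a::{real_vector, topological_space} \<Rightarrow> real. linear f \<and> continuous_on UNIV f}"
  morphisms pairing Dual
  by (rule exI[of _ "\<lambda>_. 0"]) (auto intro: linearI)

setup_lifting type_definition_dual

lemma linear_pairing: "linear (pairing f)"
  and continuous_on_pairing: "continuous_on UNIV (pairing f)"
  using pairing[of f] by auto

instantiation dual :: ("{real_vector, topological_space}") real_vector
begin

lift_definition zero_dual :: "'a dual" is "\<lambda>_. 0"
  by (auto intro: linearI)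

lift_definition plus_dual :: "'a dual \<Rightarrow> 'a dual \<Rightarrow> 'a dual" is "\<lambda>f g x. f x + g x"
  by (auto intro: linear_compose_add continuous_on_add)

lift_definition uminus_dual :: "'a dual \<Rightarrow> 'a dual" is "\<lambda>f x. - f x"
  by (auto intro: linear_compose_neg continuous_on_minus)

lift_definition minus_dual :: "'a dual \<Rightarrow> 'a dual \<Rightarrow> 'a dual" is "\<lambda>f g x. f x - g x"
  by (auto intro: linear_compose_sub continuous_on_diff)

lift_definition scaleR_dual :: "real \<Rightarrow> 'a dual \<Rightarrow> 'a dual" is "\<lambda>r f x. r * f x"
  by (auto simp: linear_iff algebra_simps intro: continuous_on_mult_left)

instance
  by standard (transfer; auto simp: algebra_simps fun_eq_iff)+

end

text \<open>
  The weak* topology is the initial topology for \<open>pairing\<close>, where the function type carries its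
  library topology, the product topology (pointwise convergence).
\<close>

instantiation dual :: ("{real_vector, topological_space}") topological_space
begin

definition open_dual :: "'a dual set \<Rightarrow> bool"
  where "open_dual A \<longleftrightarrow> (\<exists>W. open W \<and> A = pairing -` W)"

instance
proof
  show "open (UNIV :: 'a dual set)"
    unfolding open_dual_def by (rule exI[of _ UNIV]) simp
  fix A B :: "'a dual set"
  assume "open A" "open B"
  then show "open (A \<inter> B)"
    unfolding open_dual_def by (metis open_Int vimage_Int)
next
  fix K :: "'a dual set set"
  assume "\<forall>A\<in>K. open A"
  then obtain W where W: "\<forall>A\<in>K. open (W A) \<and> A = pairing -` W A"
    unfolding open_dual_def by metis
  then have "open (\<Union>(W ` K))" "\<Union>K = pairing -` \<Union>(W ` K)"
    by blast+
  then show "open (\<Union>K)"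
    unfolding open_dual_def by blast
qed

end


section \<open>Extended mappings into a space ordered by a cone\<close>

text \<open>
  A mapping into \<open>Z\<close> with an added greatest element \<open>+\<infinity>\<close> is a function into \<open>'z option\<close>, where
  \<open>None\<close> is \<open>+\<infinity>\<close>; its effective domain is then \<^const>\<open>dom\<close>.
\<close>

definition dual_cone :: "'z::{real_vector, topological_space} set \<Rightarrow> 'z dual set"
  where "dual_cone S = {l. \<forall>s\<in>S. 0 \<le> pairing l s}"

definition proper_mapping :: "('x \<Rightarrow> 'z option) \<Rightarrow> bool"
  where "proper_mapping G \<longleftrightarrow> dom G \<noteq> {}"

definition cone_epi :: "'z::real_vector set \<Rightarrow> ('x \<Rightarrow> 'z option) \<Rightarrow> ('x \<times> 'z) set"
  where "cone_epi S G = {(x, z). x \<in> dom G \<and> (\<exists>s\<in>S. z = the (G x) + s)}"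

definition cone_convex :: "'z::real_vector set \<Rightarrow> ('x::real_vector \<Rightarrow> 'z option) \<Rightarrow> bool"
  where "cone_convex S G \<longleftrightarrow> convex (cone_epi S G)"

definition cone_epi_closed ::
    "'z::{real_vector, topological_space} set \<Rightarrow> ('x::topological_space \<Rightarrow> 'z option) \<Rightarrow> bool"
  where "cone_epi_closed S G \<longleftrightarrow> closed (cone_epi S G)"

definition scalarization ::
    "'z::{real_vector, topological_space} dual \<Rightarrow> ('x \<Rightarrow> 'z option) \<Rightarrow> 'x \<Rightarrow> ereal"
  where "scalarization l G x = (case G x of None \<Rightarrow> \<infinity> | Some z \<Rightarrow> ereal (pairing l z))"


section \<open>Conjugates\<close>

definition conjugate ::
    "('x::{real_vector, topological_space} \<Rightarrow> ereal) \<Rightarrow> 'x dual \<Rightarrow> ereal"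
  where "conjugate f x' = (SUP x. ereal (pairing x' x) - f x)"

definition epi :: "('a \<Rightarrow> ereal) \<Rightarrow> ('a \<times> real) set"
  where "epi f = {(a, r). f a \<le> ereal r}"


section \<open>The robust problem and its dual\<close>

definition feasible_set :: "'z::real_vector set \<Rightarrow> 'u set \<Rightarrow> ('u \<Rightarrow> 'x \<Rightarrow> 'z option) \<Rightarrow> 'x set"
  where "feasible_set S U G = {x. \<forall>u\<in>U. G u x \<in> Some ` uminus ` S}"

definition inf_RP ::
    "'z::real_vector set \<Rightarrow> 'u set \<Rightarrow> ('u \<Rightarrow> 'x \<Rightarrow> 'z option)
      \<Rightarrow> 'x::{real_vector, topological_space} dual \<Rightarrow> ereal"
  where "inf_RP S U G c = (INF x\<in>feasible_set S U G. ereal (pairing c x))"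

definition dual_objective ::
    "('u \<Rightarrow> 'x \<Rightarrow> 'z option) \<Rightarrow> 'x::{real_vector, topological_space} dual
      \<Rightarrow> 'u \<Rightarrow> 'z::{real_vector, topological_space} dual \<Rightarrow> ereal"
  where "dual_objective G c u l = (INF x. ereal (pairing c x) + scalarization l (G u) x)"

definition sup_RD ::
    "'z::{real_vector, topological_space} set \<Rightarrow> 'u set \<Rightarrow> ('u \<Rightarrow> 'x \<Rightarrow> 'z option)
      \<Rightarrow> 'x::{real_vector, topological_space} dual \<Rightarrow> ereal"
  where "sup_RD S U G c = (SUP (u, l)\<in>U \<times> dual_cone S. dual_objective G c u l)"

definition robust_strong_duality ::
    "'z::{real_vector, topological_space} set \<Rightarrow> 'u set \<Rightarrow> ('u \<Rightarrow> 'x \<Rightarrow> 'z option)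
      \<Rightarrow> 'x::{real_vector, topological_space} dual \<Rightarrow> bool"
  where "robust_strong_duality S U G c \<longleftrightarrow>
    inf_RP S U G c = sup_RD S U G c \<and>
    (\<exists>u\<in>U. \<exists>l\<in>dual_cone S. dual_objective G c u l = sup_RD S U G c)"

definition robust_moment_set ::
    "'z::{real_vector, topological_space} set \<Rightarrow> 'u set \<Rightarrow> ('u \<Rightarrow> 'x \<Rightarrow> 'z option)
      \<Rightarrow> ('x::{real_vector, topological_space} dual \<times> real) set"
  where "robust_moment_set S U G =
    (\<Union>(u, l)\<in>U \<times> dual_cone S. epi (conjugate (scalarization l (G u))))"

end

theory Submission
  imports Defs
begin

text \<open>
  Let \<open>F\<close> be the feasible set. Unwinding the definitions, stable robust strong duality says that
  the moment set \<open>M\<close> equals the epigraph \<open>E\<close> of the support function of \<open>F\<close>. As \<open>E\<close> is an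
  intersection of closed half-spaces, duality implies that \<open>M\<close> is closed and convex. Conversely,
  separating \<open>(x, 0)\<close> from the closed convex epigraphs of the \<open>G u\<close> shows that \<open>F\<close> consists of all
  \<open>x\<close> with \<open>\<langle>y, x\<rangle> \<le> r\<close> for every \<open>(y, r) \<in> M\<close>. If \<open>M\<close> is closed and convex, it is a closed convex
  cone, a point of \<open>E\<close> outside of it is separated from it by some \<open>(x, b) \<in> X \<times> \<real>\<close>, and \<open>(x, b)\<close>
  yields a point of \<open>F\<close> (if \<open>b < 0\<close>) or a recession direction of \<open>F\<close> (if \<open>b = 0\<close>) violating
  membership in \<open>E\<close>.
\<close>

section \<open>The Hahn--Banach theorem\<close>

text \<open>Subadditivity of a functional defined by infima reduces to an inequality between single
  terms: fix \<open>j\<close>, take the infimum over \<open>i\<close>, then vary \<open>j\<close>.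
  Flattenings, infima of chains and gauges all rely on this.\<close>

lemma le_cINF_add:
  fixes f :: "'a \<Rightarrow> real" and g :: "'b \<Rightarrow> real"
  assumes "A \<noteq> {}" "B \<noteq> {}" and le: "\<And>i j. i \<in> A \<Longrightarrow> j \<in> B \<Longrightarrow> c \<le> f i + g j"
  shows "c \<le> (INF i\<in>A. f i) + (INF j\<in>B. g j)"
proof -
  have "c - g j \<le> (INF i\<in>A. f i)" if "j \<in> B" for j
    using le that by (intro cINF_greatest) (auto simp: assms algebra_simps)
  then have "c - (INF i\<in>A. f i) \<le> (INF j\<in>B. g j)"
    by (intro cINF_greatest) (auto simp: assms algebra_simps)
  then show ?thesis by simp
qed

lemma le_mult_cINF:
  fixes f :: "'a \<Rightarrow> real"
  assumes "A \<noteq> {}" "0 < t" and le: "\<And>i. i \<in> A \<Longrightarrow> c \<le> t * f i"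
  shows "c \<le> t * (INF i\<in>A. f i)"
proof -
  have "c / t \<le> (INF i\<in>A. f i)"
    using assms by (intro cINF_greatest) (auto simp: field_simps)
  then show ?thesis using \<open>0 < t\<close> by (simp add: field_simps)
qed

section \<open>Sublinear functionals and their minimal elements\<close>

definition sublinear :: "('a::real_vector \<Rightarrow> real) \<Rightarrow> bool"
  where "sublinear p \<longleftrightarrow>
    (\<forall>x y. p (x + y) \<le> p x + p y) \<and> (\<forall>t x. 0 < t \<longrightarrow> p (t *\<^sub>R x) \<le> t * p x)"

lemma sublinear_add: "sublinear p \<Longrightarrow> p (x + y) \<le> p x + p y"
  by (simp add: sublinear_def)

text \<open>The defining inequality for \<open>inverse t\<close> at the point
  \<open>t *\<^sub>R x\<close> is the reverse inequality, so the one-sided condition is all that has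
  to be checked for an infimum.\<close>

lemma sublinear_scaleR:
  assumes "sublinear p" "0 < t"
  shows "p (t *\<^sub>R x) = t * p x"
proof (rule antisym)
  show "p (t *\<^sub>R x) \<le> t * p x"
    using assms by (simp add: sublinear_def)
  have "0 < inverse t \<Longrightarrow> p (inverse t *\<^sub>R (t *\<^sub>R x)) \<le> inverse t * p (t *\<^sub>R x)"
    using assms(1) unfolding sublinear_def by blast
  then show "t * p x \<le> p (t *\<^sub>R x)"
    using assms(2) by (simp add: field_simps)
qed

lemma sublinear_0:
  assumes "sublinear p"
  shows "p 0 = 0"
  using sublinear_scaleR[OF assms, of 2 0] by simp

lemma sublinear_minus:
  assumes "sublinear p"
  shows "- p (- x) \<le> p x"
  using sublinear_add[OF assms, of x "- x"] sublinear_0[OF assms] by simp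

text \<open>The largest sublinear functional below \<open>p\<close> with value at most \<open>- p y\<close> at \<open>- y\<close>.\<close>

definition flatten :: "('a::real_vector \<Rightarrow> real) \<Rightarrow> 'a \<Rightarrow> 'a \<Rightarrow> real"
  where "flatten p y x = (INF t\<in>{0..}. p (x + t *\<^sub>R y) - t * p y)"

text \<open>The parameters \<open>t = 0\<close> and \<open>t = 1\<close> give the two bounds. For
  subadditivity the parameters \<open>s\<close> and \<open>t\<close> of the summands are added; for
  homogeneity \<open>t\<close> is rescaled to \<open>a * t\<close>.\<close>

lemma
  assumes p: "sublinear p"
  shows sublinear_flatten: "sublinear (flatten p y)"
    and flatten_le: "flatten p y x \<le> p x"
    and flatten_minus: "flatten p y (- y) \<le> - p y"
proof -
  have scale: "p (t *\<^sub>R z) = t * p z" if "0 \<le> t" for t z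
    using that sublinear_scaleR[OF p, of t z] sublinear_0[OF p] by (cases "t = 0") auto
  \<comment> \<open>Adding \<open>- x\<close> isolates \<open>p (t *\<^sub>R y) = t * p y\<close>,
    which cancels and leaves a lower bound independent of \<open>t\<close>.\<close>
  have "- p (- x) \<le> p (x + t *\<^sub>R y) - t * p y" if "0 \<le> t" for x t
    using sublinear_add[OF p, of "x + t *\<^sub>R y" "- x"] scale[OF that] by simp
  then have bdd: "bdd_below ((\<lambda>t. p (x + t *\<^sub>R y) - t * p y) ` {0..})" for x
    by (intro bdd_belowI2[where m = "- p (- x)"]) auto
  have le: "flatten p y x \<le> p (x + t *\<^sub>R y) - t * p y" if "0 \<le> t" for x t
    unfolding flatten_def by (rule cINF_lower[OF bdd]) (use that in simp)
  show "flatten p y x \<le> p x"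
    using le[of 0 x] by simp
  show "flatten p y (- y) \<le> - p y"
    using le[of 1 "- y"] sublinear_0[OF p] by simp
  show "sublinear (flatten p y)"
    unfolding sublinear_def
  proof (intro conjI allI impI)
    fix x z
    show "flatten p y (x + z) \<le> flatten p y x + flatten p y z"
      unfolding flatten_def[of p y x] flatten_def[of p y z]
    proof (rule le_cINF_add)
      fix s t :: real assume "s \<in> {0..}" "t \<in> {0..}"
      then have "flatten p y (x + z) \<le> p ((x + z) + (s + t) *\<^sub>R y) - (s + t) * p y"
        by (intro le) simp
      also have "(x + z) + (s + t) *\<^sub>R y = (x + s *\<^sub>R y) + (z + t *\<^sub>R y)"
        by (simp add: algebra_simps)
      also have "p \<dots> - (s + t) * p y
          \<le> (p (x + s *\<^sub>R y) - s * p y) + (p (z + t *\<^sub>R y) - t * p y)"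
        using sublinear_add[OF p, of "x + s *\<^sub>R y" "z + t *\<^sub>R y"] by (simp add: algebra_simps)
      finally show "flatten p y (x + z)
          \<le> (p (x + s *\<^sub>R y) - s * p y) + (p (z + t *\<^sub>R y) - t * p y)" .
    qed auto
  next
    fix a :: real and x assume a: "0 < a"
    show "flatten p y (a *\<^sub>R x) \<le> a * flatten p y x"
      unfolding flatten_def[of p y x]
    proof (rule le_mult_cINF[OF _ a])
      fix t :: real assume "t \<in> {0..}"
      then have "flatten p y (a *\<^sub>R x) \<le> p (a *\<^sub>R x + (a * t) *\<^sub>R y) - (a * t) * p y"
        using a by (intro le) simp
      also have "a *\<^sub>R x + (a * t) *\<^sub>R y = a *\<^sub>R (x + t *\<^sub>R y)"
        by (simp add: algebra_simps)
      also have "p \<dots> = a * p (x + t *\<^sub>R y)"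
        using a by (intro scale) simp
      finally show "flatten p y (a *\<^sub>R x) \<le> a * (p (x + t *\<^sub>R y) - t * p y)"
        by (simp add: algebra_simps)
    qed auto
  qed
qed

text \<open>Of two members of a chain the smaller one serves at both points, so its own
  subadditivity bounds the infimum at \<open>x + y\<close>.\<close>

lemma sublinear_INF_chain:
  assumes "C \<noteq> {}" and sub: "\<And>p. p \<in> C \<Longrightarrow> sublinear p"
    and chain: "\<And>p p'. p \<in> C \<Longrightarrow> p' \<in> C \<Longrightarrow> p \<le> p' \<or> p' \<le> p"
    and bdd: "\<And>x. bdd_below ((\<lambda>p. p x) ` C)"
  shows "sublinear (\<lambda>x. INF p\<in>C. p x)" (is "sublinear ?u")
  unfolding sublinear_def
proof (intro conjI allI impI)
  have le: "?u x \<le> p x" if "p \<in> C" for p x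
    by (rule cINF_lower[OF bdd that])
  fix x y
  show "?u (x + y) \<le> ?u x + ?u y"
  proof (rule le_cINF_add)
    fix p p' assume p: "p \<in> C" "p' \<in> C"
    then consider "p \<le> p'" | "p' \<le> p" using chain by blast
    then show "?u (x + y) \<le> p x + p' y"
    proof cases
      case 1
      then show ?thesis
        using le[OF p(1), of "x + y"] sublinear_add[OF sub[OF p(1)], of x y] le_funD[OF 1, of y]
        by linarith
    next
      case 2
      then show ?thesis
        using le[OF p(2), of "x + y"] sublinear_add[OF sub[OF p(2)], of x y] le_funD[OF 2, of x]
        by linarith
    qed
  qed (use assms in auto)
  fix t :: real assume t: "0 < t"
  show "?u (t *\<^sub>R x) \<le> t * ?u x"
  proof (rule le_mult_cINF[OF \<open>C \<noteq> {}\<close> t])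
    fix p assume "p \<in> C"
    then show "?u (t *\<^sub>R x) \<le> t * p x"
      using le[of p "t *\<^sub>R x"] sublinear_scaleR[OF sub t] by simp
  qed
qed

text \<open>A minimal sublinear functional is linear, since it agrees with its flattenings.\<close>

lemma sublinear_dominates_linear:
  assumes q: "sublinear q"
  obtains f where "linear f" "f \<le> q"
proof -
  define A where "A = {p. sublinear p \<and> p \<le> q}"
  \<comment> \<open>The order is reversed, so that a maximal element from Zorn's lemma is a
    pointwise minimal sublinear functional.\<close>
  define R where "R = (\<lambda>p p' :: 'a \<Rightarrow> real. p' \<le> p)"
  have "\<exists>m\<in>A. \<forall>p\<in>A. R m p \<longrightarrow> p = m"
  proof (rule predicate_Zorn)
    show "partial_order_on A (relation_of R A)"
      by (rule partial_order_on_relation_ofI) (auto simp: R_def)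
    fix C assume C: "C \<in> Chains (relation_of R A)"
    have CA: "C \<subseteq> A"
      using C Chains_relation_of by blast
    show "\<exists>u\<in>A. \<forall>p\<in>C. R p u"
    proof (cases "C = {}")
      case True
      then show ?thesis using q by (auto simp: A_def)
    next
      case False
      have chain: "p \<le> p' \<or> p' \<le> p" if "p \<in> C" "p' \<in> C" for p p'
        using C that by (auto simp: Chains_def relation_of_def R_def)
      \<comment> \<open>A lower bound common to the whole chain: \<open>p x\<close> is at least
        \<open>- p (- x)\<close>, which is at least \<open>- q (- x)\<close>.\<close>
      have "- q (- x) \<le> p x" if p: "p \<in> C" for p x
      proof -
        have "sublinear p" "p (- x) \<le> q (- x)"
          using p CA by (auto simp: A_def le_fun_def)
        then show ?thesis
          using sublinear_minus[of p x] by linarith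
      qed
      then have bdd: "bdd_below ((\<lambda>p. p x) ` C)" for x
        by (intro bdd_belowI2[where m = "- q (- x)"])
      define u where "u = (\<lambda>x. INF p\<in>C. p x)"
      have le: "u \<le> p" if "p \<in> C" for p
        unfolding u_def le_fun_def using cINF_lower[OF bdd that] by blast
      have "sublinear u"
        unfolding u_def using False CA chain bdd by (intro sublinear_INF_chain) (auto simp: A_def)
      moreover obtain p where "p \<in> C" using False by blast
      then have "u \<le> q"
        using CA le[of p] order_trans[of u p q] by (auto simp: A_def)
      ultimately show ?thesis
        using le by (auto simp: A_def R_def)
    qed
  qed
  then obtain m where "m \<in> A" and m_min: "\<And>p. p \<in> A \<Longrightarrow> p \<le> m \<Longrightarrow> p = m"
    unfolding R_def by blast
  then have m: "sublinear m" "m \<le> q"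
    by (simp_all add: A_def)
  have min: "p = m" if "sublinear p" "p \<le> m" for p
    using m_min[of p] that order_trans[OF that(2) m(2)] by (simp add: A_def)
  have "flatten m y = m" for y
    using sublinear_flatten[OF m(1)] flatten_le[OF m(1)] by (intro min) (auto simp: le_fun_def)
  then have odd: "m (- y) = - m y" for y
    using flatten_minus[OF m(1), of y] sublinear_minus[OF m(1), of y] by simp
  have "linear m"
  proof (rule linearI)
    \<comment> \<open>The reverse inequality is subadditivity for \<open>x = (x + y) + (- y)\<close>
      combined with oddness.\<close>
    show "m (x + y) = m x + m y" for x y
      using sublinear_add[OF m(1), of x y] sublinear_add[OF m(1), of "x + y" "- y"] odd[of y]
      by simp
    show "m (t *\<^sub>R x) = t *\<^sub>R m x" for t x
    proof (cases t "0 :: real" rule: linorder_cases)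
      case less
      then show ?thesis
        using sublinear_scaleR[OF m(1), of "- t" x] odd[of "t *\<^sub>R x"] by simp
    qed (use sublinear_scaleR[OF m(1)] sublinear_0[OF m(1)] in auto)
  qed
  then show thesis using m(2) that by blast
qed

text \<open>A linear functional below \<open>flatten q a\<close> is at most \<open>- q a\<close> at
  \<open>- a\<close>, hence at least \<open>q a\<close> at \<open>a\<close>, where domination by
  \<open>q\<close> forces equality.\<close>

lemma Hahn_Banach_sublinear:
  assumes q: "sublinear q"
  obtains f where "linear f" "f \<le> q" "f a = q a"
proof -
  obtain f where f: "linear f" "f \<le> flatten q a"
    using sublinear_dominates_linear[OF sublinear_flatten[OF q]] .
  have le: "f x \<le> q x" for x
    using le_funD[OF f(2), of x] flatten_le[OF q, of a x] by simp
  have "f (- a) \<le> - q a"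
    using le_funD[OF f(2), of "- a"] flatten_minus[OF q, of a] by simp
  then have "f a = q a"
    using le[of a] linear_neg[OF f(1), of a] by simp
  then show thesis using that f(1) le by (simp add: le_fun_def)
qed

section \<open>Separation\<close>

text \<open>An algebraic substitute for neighbourhoods of 0: separation can be proved in a bare real
  vector space and then applied both to products and to the weak* dual. Asking for all small
  \<open>t > 0\<close> makes the notion stable under products.\<close>

definition absorbing :: "'a::real_vector set \<Rightarrow> bool"
  where "absorbing V \<longleftrightarrow> (\<forall>x. \<forall>\<^sub>F t in at_right 0. t *\<^sub>R x \<in> V)"

lemma absorbing_obtains:
  assumes "absorbing V"
  obtains t where "0 < t" "t *\<^sub>R x \<in> V"
proof -
  have "\<forall>\<^sub>F t in at_right (0::real). t *\<^sub>R x \<in> V \<and> 0 < t"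
    using assms eventually_at_right_less[of 0]
    unfolding absorbing_def by (intro eventually_conj) auto
  then show thesis
    using that eventually_happens'[OF trivial_limit_at_right_real] by blast
qed

lemma absorbing_0: "absorbing V \<Longrightarrow> 0 \<in> V"
  using absorbing_obtains[of V 0] by auto

lemma absorbing_mono: "absorbing V \<Longrightarrow> V \<subseteq> W \<Longrightarrow> absorbing W"
  unfolding absorbing_def by (blast intro: eventually_mono)

lemma absorbing_Times:
  assumes "absorbing V" "absorbing W"
  shows "absorbing (V \<times> W)"
  using assms by (auto simp: absorbing_def intro: eventually_conj)

section \<open>Minkowski functionals and algebraic separation\<close>

definition gauge_of :: "'a::real_vector set \<Rightarrow> 'a \<Rightarrow> real"
  where "gauge_of D x = (INF t\<in>{t. 0 < t \<and> x /\<^sub>R t \<in> D}. t)"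

text \<open>Subadditivity: \<open>(x + y) / (s + t)\<close> is the convex combination of
  \<open>x / s\<close> and \<open>y / t\<close> with weights \<open>s / (s + t)\<close> and
  \<open>t / (s + t)\<close>. The bound outside \<open>D\<close> holds because \<open>x / t\<close>
  in \<open>D\<close> with \<open>t < 1\<close> would put \<open>x\<close>, which lies between 0 and
  \<open>x / t\<close>, into \<open>D\<close>.\<close>

lemma
  assumes D: "convex D" "absorbing D"
  shows sublinear_gauge_of: "sublinear (gauge_of D)"
    and gauge_of_le_1: "x \<in> D \<Longrightarrow> gauge_of D x \<le> 1"
    and gauge_of_ge_1: "x \<notin> D \<Longrightarrow> 1 \<le> gauge_of D x"
proof -
  define T where "T x = {t. 0 < t \<and> x /\<^sub>R t \<in> D}" for x
  have gauge_T: "gauge_of D x = (INF t\<in>T x. t)" for x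
    by (simp add: gauge_of_def T_def)
  have ne: "T x \<noteq> {}" for x
  proof -
    obtain t where "0 < t" "t *\<^sub>R x \<in> D"
      using absorbing_obtains[OF D(2)] .
    then have "inverse t \<in> T x" by (simp add: T_def)
    then show ?thesis by blast
  qed
  have bdd: "bdd_below ((\<lambda>t. t) ` T x)" for x
    by (rule bdd_belowI2[where m = 0]) (auto simp: T_def)
  have le: "gauge_of D x \<le> t" if "t \<in> T x" for x t
    unfolding gauge_T by (rule cINF_lower[OF bdd that])
  show "x \<in> D \<Longrightarrow> gauge_of D x \<le> 1"
    by (rule le) (simp add: T_def)
  show "1 \<le> gauge_of D x" if "x \<notin> D"
    unfolding gauge_T
  proof (rule cINF_greatest[OF ne], rule ccontr)
    fix t assume "t \<in> T x" "\<not> 1 \<le> t"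
    then have "t *\<^sub>R (x /\<^sub>R t) + (1 - t) *\<^sub>R 0 \<in> D"
      using absorbing_0[OF D(2)] by (intro convexD[OF D(1)]) (auto simp: T_def)
    then show False
      using that \<open>t \<in> T x\<close> by (simp add: T_def)
  qed
  show "sublinear (gauge_of D)"
    unfolding sublinear_def
  proof (intro conjI allI impI)
    fix x y
    show "gauge_of D (x + y) \<le> gauge_of D x + gauge_of D y"
      unfolding gauge_T[of x] gauge_T[of y]
    proof (rule le_cINF_add[OF ne ne])
      fix s t assume st: "s \<in> T x" "t \<in> T y"
      then have pos: "0 < s" "0 < t" by (simp_all add: T_def)
      have "(s / (s + t)) *\<^sub>R (x /\<^sub>R s) + (t / (s + t)) *\<^sub>R (y /\<^sub>R t) \<in> D"
        using st by (intro convexD[OF D(1)]) (auto simp: T_def add_divide_distrib[symmetric])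
      moreover have "(s / (s + t)) *\<^sub>R (x /\<^sub>R s) + (t / (s + t)) *\<^sub>R (y /\<^sub>R t)
          = (x + y) /\<^sub>R (s + t)"
      proof -
        have "s / (s + t) * inverse s = inverse (s + t)" "t / (s + t) * inverse t = inverse (s + t)"
          using pos by (simp_all add: field_simps)
        then show ?thesis by (simp add: scaleR_add_right)
      qed
      ultimately have "s + t \<in> T (x + y)"
        using st by (simp add: T_def)
      then show "gauge_of D (x + y) \<le> s + t" by (rule le)
    qed
  next
    fix t :: real and x assume t: "0 < t"
    show "gauge_of D (t *\<^sub>R x) \<le> t * gauge_of D x"
      unfolding gauge_T[of x]
    proof (rule le_mult_cINF[OF ne t])
      fix s assume s: "s \<in> T x"
      have "inverse (t * s) * t = inverse s"
        using t by simp
      then have "t * s \<in> T (t *\<^sub>R x)"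
        using s t by (simp add: T_def del: inverse_mult_distrib)
      then show "gauge_of D (t *\<^sub>R x) \<le> t * s" by (rule le)
    qed
  qed
qed

text \<open>Hahn--Banach is applied at \<open>a - c\<close> to the gauge of
  \<open>D = V + (C - c)\<close>, which is at least 1 there. Symmetry of \<open>V\<close> turns
  \<open>f v \<le> 1\<close> into a bound on \<open>\<bar>f v\<bar>\<close>, from which continuity
  is derived later.\<close>

lemma convex_separation:
  fixes C V :: "'a::real_vector set"
  assumes C: "convex C" "C \<noteq> {}"
    and V: "convex V" "absorbing V" "\<And>v. v \<in> V \<Longrightarrow> - v \<in> V"
    and disj: "\<And>v. v \<in> V \<Longrightarrow> a + v \<notin> C"
  obtains f :: "'a \<Rightarrow> real" and \<delta> where "linear f" "\<And>v. v \<in> V \<Longrightarrow> \<bar>f v\<bar> \<le> 1"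
    "0 < \<delta>" "\<And>x. x \<in> C \<Longrightarrow> f x + \<delta> \<le> f a"
proof -
  obtain c where c: "c \<in> C" using C by blast
  define D where "D = (\<Union>v\<in>V. \<Union>w\<in>(\<lambda>x. x - c) ` C. {v + w})"
  have VD: "V \<subseteq> D"
    using c by (force simp: D_def)
  have D: "convex D"
    unfolding D_def using V(1) C(1) by (intro convex_sums) simp_all
  have D': "absorbing D"
    using absorbing_mono[OF V(2) VD] .
  have "a - c \<notin> D"
  proof
    assume "a - c \<in> D"
    then obtain v x where "v \<in> V" "x \<in> C" "a - c = v + (x - c)"
      by (auto simp: D_def)
    \<comment> \<open>By symmetry \<open>- v\<close> is in \<open>V\<close>, and
      \<open>a + (- v) = x\<close> would lie in \<open>C\<close>.\<close>
    then show False
      using disj[OF V(3), of v] by (simp add: algebra_simps)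
  qed
  then have ge: "1 \<le> gauge_of D (a - c)"
    by (rule gauge_of_ge_1[OF D D'])
  obtain f where f: "linear f" "f \<le> gauge_of D" "f (a - c) = gauge_of D (a - c)"
    using Hahn_Banach_sublinear[OF sublinear_gauge_of[OF D D']] .
  have le: "f x \<le> 1" if "x \<in> D" for x
    using le_funD[OF f(2), of x] gauge_of_le_1[OF D D' that] by simp
  have abs: "\<bar>f v\<bar> \<le> 1" if "v \<in> V" for v
  proof -
    have "v \<in> D" "- v \<in> D" using that V(3)[OF that] VD by auto
    then show ?thesis
      using le[of v] le[of "- v"] linear_neg[OF f(1), of v] by simp
  qed
  \<comment> \<open>This \<open>t\<close> becomes the gap \<open>\<delta>\<close>: \<open>f\<close>
    is at most 1 on \<open>D\<close>, whereas \<open>f (a - c)\<close> is at least 1 and so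
    \<open>t * f (a - c)\<close> is at least \<open>t\<close>.\<close>
  obtain t where t: "0 < t" "t *\<^sub>R (a - c) \<in> V"
    using absorbing_obtains[OF V(2)] .
  have "f x + t \<le> f a" if "x \<in> C" for x
  proof -
    have "t *\<^sub>R (a - c) + (x - c) \<in> D"
      using t that by (auto simp: D_def)
    then have "t * f (a - c) + (f x - f c) \<le> 1"
      using le by (fastforce simp: linear_add[OF f(1)] linear_diff[OF f(1)] linear_scale[OF f(1)])
    moreover have "t \<le> t * f (a - c)"
      using ge t f(3) by simp
    ultimately show ?thesis
      using ge f(3) linear_diff[OF f(1), of a c] by simp
  qed
  then show thesis
    using that[OF f(1) abs t(1)] by blast
qed

section \<open>Continuity and separation in products of locally convex spaces\<close>

lemma tendsto_scaleR_tvs: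
  fixes x :: "'a::real_topological_vector_space"
  assumes "(f \<longlongrightarrow> r) F" "(g \<longlongrightarrow> x) F"
  shows "((\<lambda>i. f i *\<^sub>R g i) \<longlongrightarrow> r *\<^sub>R x) F"
  using filterlim_compose[OF tendsto_scaleR_nhds_Pair filterlim_Pair[OF assms]] by simp

lemma absorbing_open:
  fixes V :: "'a::real_topological_vector_space set"
  assumes "open V" "0 \<in> V"
  shows "absorbing V"
  unfolding absorbing_def
proof
  fix x :: 'a
  have "((\<lambda>t. t *\<^sub>R x) \<longlongrightarrow> 0 *\<^sub>R x) (at_right 0)"
    by (intro tendsto_scaleR_tvs tendsto_ident_at tendsto_const)
  then show "\<forall>\<^sub>F t in at_right 0. t *\<^sub>R x \<in> V"
    using assms by (auto dest: topological_tendstoD)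
qed

lemma continuous_on_linear_bounded:
  fixes f :: "'a::real_topological_vector_space \<Rightarrow> real"
  assumes f: "linear f" and V: "open V" "0 \<in> V" "\<And>v. v \<in> V \<Longrightarrow> \<bar>f v\<bar> \<le> B"
  shows "continuous_on UNIV f"
  unfolding continuous_on_def
proof (intro ballI tendstoI)
  fix x :: 'a and e :: real assume e: "0 < e"
  \<comment> \<open>Once \<open>k *\<^sub>R (y - x)\<close> is in \<open>V\<close>, the increment of
    \<open>f\<close> is below \<open>(\<bar>B\<bar> + 1) / k = e\<close>; the summand 1 keeps
    \<open>k\<close> positive and the inequality strict.\<close>
  define k where "k = (\<bar>B\<bar> + 1) / e"
  have k: "0 < k" using e by (simp add: k_def)
  have "((\<lambda>y. k *\<^sub>R (y - x)) \<longlongrightarrow> k *\<^sub>R (x - x)) (at x)"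
    by (intro tendsto_scaleR_tvs tendsto_diff tendsto_ident_at tendsto_const)
  then have "\<forall>\<^sub>F y in at x. k *\<^sub>R (y - x) \<in> V"
    using V by (auto dest: topological_tendstoD)
  then show "\<forall>\<^sub>F y in at x. dist (f y) (f x) < e"
  proof eventually_elim
    case (elim y)
    have "k * \<bar>f y - f x\<bar> = \<bar>f (k *\<^sub>R (y - x))\<bar>"
      using k by (simp add: linear_scale[OF f] linear_diff[OF f] abs_mult)
    also have "\<dots> < \<bar>B\<bar> + 1"
      using V(3)[OF elim] by linarith
    also have "\<dots> = k * e"
      using e by (simp add: k_def)
    finally show ?case
      using k by (simp add: dist_real_def)
  qed
qed

text \<open>Translate \<open>W\<close> to the origin and intersect a convex neighbourhood with its
  reflection.\<close>

lemma locally_convex_symmetric_nhd: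
  fixes W :: "'a::locally_convex_t2_space set"
  assumes "open W" "a \<in> W"
  obtains V where "open V" "convex V" "0 \<in> V" "\<And>v. v \<in> V \<Longrightarrow> - v \<in> V" "\<And>v. v \<in> V \<Longrightarrow> a + v \<in> W"
proof -
  have "open ((\<lambda>v. a + v) -` W)"
    by (intro open_vimage assms continuous_intros)
  then obtain V where V: "open V" "convex V" "0 \<in> V" "V \<subseteq> (\<lambda>v. a + v) -` W"
    using locally_convex_at_0'[of "(\<lambda>v. a + v) -` W"] assms by auto
  have "open (uminus -` V)"
    by (intro open_vimage V continuous_intros)
  moreover have "convex (uminus -` V)"
    using V(2) by (intro convex_linear_vimage) (auto intro: linearI)
  ultimately show thesis
    using V by (intro that[of "V \<inter> uminus -` V"]) (auto intro: convex_Int)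
qed

lemma pairing_Dual:
  assumes "linear f" "continuous_on UNIV f"
  shows "pairing (Dual f) = f"
  using assms by (simp add: Dual_inverse)

text \<open>A box \<open>V \<times> W\<close> of symmetric convex neighbourhoods is the absorbing
  set. The separating functional splits into \<open>f (x, 0)\<close> and \<open>f (0, z)\<close>;
  each is bounded on its factor of the box, hence continuous and an element of the dual.\<close>

lemma separation_Times:
  fixes C :: "('x::locally_convex_t2_space \<times> 'z::locally_convex_t2_space) set"
  assumes C: "closed C" "convex C" "C \<noteq> {}" and "(a, b) \<notin> C"
  obtains y l \<delta> where "0 < \<delta>"
    "\<And>x z. (x, z) \<in> C \<Longrightarrow> pairing y x + pairing l z + \<delta> \<le> pairing y a + pairing l b"
proof -
  have "open (- C)" "(a, b) \<in> - C"
    using assms by (simp_all add: open_Compl)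
  then obtain A B where "open A" "open B" "(a, b) \<in> A \<times> B" "A \<times> B \<subseteq> - C"
    by (rule open_prod_elim)
  then have AB: "open A" "open B" "a \<in> A" "b \<in> B" "A \<times> B \<subseteq> - C"
    by simp_all
  obtain V where V: "open V" "convex V" "0 \<in> V" "\<And>v. v \<in> V \<Longrightarrow> - v \<in> V"
    "\<And>v. v \<in> V \<Longrightarrow> a + v \<in> A"
    using locally_convex_symmetric_nhd[OF AB(1,3)] by blast
  obtain W where W: "open W" "convex W" "0 \<in> W" "\<And>v. v \<in> W \<Longrightarrow> - v \<in> W"
    "\<And>v. v \<in> W \<Longrightarrow> b + v \<in> B"
    using locally_convex_symmetric_nhd[OF AB(2,4)] by blast
  have VW: "convex (V \<times> W)" "absorbing (V \<times> W)"
    using V W by (auto intro!: convex_Times absorbing_Times absorbing_open)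
  have sym: "- v \<in> V \<times> W" if "v \<in> V \<times> W" for v
    using that V(4) W(4) by (cases v) auto
  have disj: "(a, b) + v \<notin> C" if "v \<in> V \<times> W" for v
    using that V(5) W(5) AB(5) by (cases v) auto
  obtain f :: "'x \<times> 'z \<Rightarrow> real" and \<delta> where f: "linear f"
    "\<And>v. v \<in> V \<times> W \<Longrightarrow> \<bar>f v\<bar> \<le> 1"
    and \<delta>: "0 < \<delta>" "\<And>x. x \<in> C \<Longrightarrow> f x + \<delta> \<le> f (a, b)"
    using convex_separation[OF C(2,3) VW sym disj] by blast
  have split: "f (x, z) = f (x, 0) + f (0, z)" for x z
    using linear_add[OF f(1), of "(x, 0)" "(0, z)"] by simp
  have lin: "linear (\<lambda>x. f (x, 0))" "linear (\<lambda>z. f (0, z))"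
    using linear_compose[of "\<lambda>x. (x, 0)" f] linear_compose[of "\<lambda>z. (0, z)" f] f(1)
    by (auto simp: linear_iff o_def)
  have y: "pairing (Dual (\<lambda>x. f (x, 0))) = (\<lambda>x. f (x, 0))"
    using f(2) V(1,3) W(3)
    by (intro pairing_Dual lin continuous_on_linear_bounded[of _ V 1]) auto
  have l: "pairing (Dual (\<lambda>z. f (0, z))) = (\<lambda>z. f (0, z))"
    using f(2) W(1,3) V(3)
    by (intro pairing_Dual lin continuous_on_linear_bounded[of _ W 1]) auto
  show thesis
  proof (rule that[OF \<delta>(1)])
    fix x z assume "(x, z) \<in> C"
    from \<delta>(2)[OF this] show "pairing (Dual (\<lambda>x. f (x, 0))) x + pairing (Dual (\<lambda>z. f (0, z))) z + \<delta>
        \<le> pairing (Dual (\<lambda>x. f (x, 0))) a + pairing (Dual (\<lambda>z. f (0, z))) b"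
      using split[of x z] split[of a b] by (simp add: y l)
  qed
qed

section \<open>Separation in the weak* topology\<close>

text \<open>Induction on \<open>I\<close>. If some \<open>v\<close> is killed by the functionals of
  \<open>I\<close> but not by \<open>g j\<close>, subtract from \<open>f\<close> the multiple of
  \<open>g j\<close> that makes it vanish at \<open>v\<close>. Otherwise \<open>g j\<close> vanishes
  on the common kernel of the others and gets coefficient 0.\<close>

lemma linear_combination_of_common_kernel:
  fixes f :: "'a::real_vector \<Rightarrow> real" and g :: "'i \<Rightarrow> 'a \<Rightarrow> real"
  assumes "finite I" "linear f" "\<And>i. i \<in> I \<Longrightarrow> linear (g i)"
    and "\<And>x. (\<And>i. i \<in> I \<Longrightarrow> g i x = 0) \<Longrightarrow> f x = 0"
  obtains \<alpha> where "\<And>x. f x = (\<Sum>i\<in>I. \<alpha> i * g i x)"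
proof -
  have "\<exists>\<alpha>. \<forall>x. f x = (\<Sum>i\<in>I. \<alpha> i * g i x)"
    using assms
  proof (induction I arbitrary: f rule: finite_induct)
    case empty
    then show ?case by simp
  next
    case (insert j I)
    note f = \<open>linear f\<close> and g = insert.prems(2)[of j, simplified]
    have sum_upd: "(\<Sum>i\<in>insert j I. (\<alpha>(j := b)) i * g i x) = b * g j x + (\<Sum>i\<in>I. \<alpha> i * g i x)"
      for \<alpha> b x
    proof -
      have "(\<Sum>i\<in>I. (\<alpha>(j := b)) i * g i x) = (\<Sum>i\<in>I. \<alpha> i * g i x)"
        using \<open>j \<notin> I\<close> by (intro sum.cong) auto
      then show ?thesis
        using insert.hyps by (simp del: fun_upd_apply add: fun_upd_same)
    qed
    show ?case
    proof (cases "\<exists>v. g j v \<noteq> 0 \<and> (\<forall>i\<in>I. g i v = 0)")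
      case True
      then obtain v where v: "g j v \<noteq> 0" "\<And>i. i \<in> I \<Longrightarrow> g i v = 0" by blast
      have "\<exists>\<alpha>. \<forall>x. f x - f v / g j v * g j x = (\<Sum>i\<in>I. \<alpha> i * g i x)"
      proof (rule insert.IH)
        show "linear (\<lambda>x. f x - f v / g j v * g j x)"
          by (rule linearI) (simp_all add: linear_add[OF f] linear_add[OF g]
            linear_scale[OF f] linear_scale[OF g] algebra_simps)
        fix x assume x: "\<And>i. i \<in> I \<Longrightarrow> g i x = 0"
        \<comment> \<open>Correcting \<open>x\<close> along \<open>v\<close> makes
          \<open>g j\<close> vanish without disturbing the other functionals.\<close>
        have "f (x - (g j x / g j v) *\<^sub>R v) = 0"
        proof (rule insert.prems(3))
          fix i assume i: "i \<in> insert j I"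
          then show "g i (x - (g j x / g j v) *\<^sub>R v) = 0"
            using v x linear_diff[OF insert.prems(2)[OF i]] linear_scale[OF insert.prems(2)[OF i]]
            by auto
        qed
        then show "f x - f v / g j v * g j x = 0"
          by (simp add: linear_diff[OF f] linear_scale[OF f])
      qed (use insert in auto)
      then obtain \<alpha> where
        \<alpha>: "\<And>x. f x - f v / g j v * g j x = (\<Sum>i\<in>I. \<alpha> i * g i x)" by blast
      have "f x = (\<Sum>i\<in>insert j I. (\<alpha>(j := f v / g j v)) i * g i x)" for x
        using \<alpha>[of x] by (simp add: sum_upd del: fun_upd_apply)
      then show ?thesis by blast
    next
      case False
      then have "\<exists>\<alpha>. \<forall>x. f x = (\<Sum>i\<in>I. \<alpha> i * g i x)"
      proof (intro insert.IH f)
        fix x assume x: "\<And>i. i \<in> I \<Longrightarrow> g i x = 0"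
        then have "g j x = 0" using False by blast
        then show "f x = 0" using x by (intro insert.prems(3)) auto
      qed (use insert.prems in simp)
      then obtain \<alpha> where \<alpha>: "\<And>x. f x = (\<Sum>i\<in>I. \<alpha> i * g i x)" by blast
      have "f x = (\<Sum>i\<in>insert j I. (\<alpha>(j := 0)) i * g i x)" for x
        using \<alpha>[of x] by (simp add: sum_upd del: fun_upd_apply)
      then show ?thesis by blast
    qed
  qed
  then show thesis using that by blast
qed

lemma continuous_on_pairing_eval: "continuous_on UNIV (\<lambda>y. pairing y x)"
proof -
  have "continuous_on UNIV (pairing :: 'a dual \<Rightarrow> _)"
    unfolding continuous_on_open_vimage[OF open_UNIV] open_dual_def by auto
  then show ?thesis
    by (rule continuous_on_product_then_coordinatewise)
qed

text \<open>A basic open set of the product topology restricts only finitely many coordinates. These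
  form \<open>I\<close>, and openness of the real factors supplies the radii.\<close>

lemma weak_star_nhd:
  fixes y :: "'a::{real_vector, topological_space} dual"
  assumes "open A" "y \<in> A"
  obtains I e where "finite I" "\<And>x. 0 < e x"
    "\<And>v. (\<And>x. x \<in> I \<Longrightarrow> \<bar>pairing v x\<bar> < e x) \<Longrightarrow> y + v \<in> A"
proof -
  obtain W where W: "open W" "A = pairing -` W"
    using assms(1) by (auto simp: open_dual_def)
  then obtain X where X: "pairing y \<in> (\<Pi>\<^sub>E i\<in>UNIV. X i)" "\<And>i. open (X i)"
    "finite {i. X i \<noteq> UNIV}" "(\<Pi>\<^sub>E i\<in>UNIV. X i) \<subseteq> W"
    using product_topology_open_contains_basis[of "\<lambda>_. euclidean" UNIV W "pairing y"] assms(2)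
    by (auto simp: open_fun_def)
  have "\<exists>e>0. \<forall>s. dist s (pairing y i) < e \<longrightarrow> s \<in> X i" for i
    using X(1) X(2)[of i] by (auto simp: open_dist)
  then obtain e where e: "\<And>i. 0 < e i" "\<And>i s. dist s (pairing y i) < e i \<Longrightarrow> s \<in> X i"
    by metis
  show thesis
  proof (rule that[OF X(3) e(1)])
    fix v assume v: "\<And>x. x \<in> {i. X i \<noteq> UNIV} \<Longrightarrow> \<bar>pairing v x\<bar> < e x"
    have "pairing (y + v) i \<in> X i" for i
      using v[of i] e(2)[of "pairing (y + v) i" i]
      by (cases "X i = UNIV") (auto simp: plus_dual.rep_eq dist_real_def)
    then show "y + v \<in> A"
      using X(4) W(2) by auto
  qed
qed

lemma pairing_sum_scaleR:
  "pairing y (\<Sum>i\<in>I. \<alpha> i *\<^sub>R i) = (\<Sum>i\<in>I. \<alpha> i * pairing y i)"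
  by (simp add: linear_sum[OF linear_pairing] linear_scale[OF linear_pairing])

text \<open>Behind this is that \<open>X\<close> is the dual of its weak* dual: a functional bounded
  on a basic neighbourhood vanishes where all evaluations at \<open>I\<close> vanish, so it is a
  linear combination of them, that is, evaluation at one point of \<open>X\<close>.\<close>

lemma weak_star_separation:
  fixes C :: "('x::{real_vector, topological_space} dual \<times> real) set"
  assumes C: "closed C" "convex C" "C \<noteq> {}" and "(y, r) \<notin> C"
  obtains x b \<delta> where "0 < \<delta>"
    "\<And>y' r'. (y', r') \<in> C \<Longrightarrow> pairing y' x + b * r' + \<delta> \<le> pairing y x + b * r"
proof -
  have "open (- C)" "(y, r) \<in> - C"
    using assms by (simp_all add: open_Compl)
  then obtain A B where "open A" "open B" "(y, r) \<in> A \<times> B" "A \<times> B \<subseteq> - C"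
    by (rule open_prod_elim)
  then have AB: "open A" "open B" "y \<in> A" "r \<in> B" "A \<times> B \<subseteq> - C"
    by simp_all
  obtain I e where I: "finite I" and e: "\<And>x. 0 < e x"
    and A: "\<And>v. (\<And>x. x \<in> I \<Longrightarrow> \<bar>pairing v x\<bar> < e x) \<Longrightarrow> y + v \<in> A"
    using weak_star_nhd[OF AB(1,3)] by metis
  obtain \<epsilon> where \<epsilon>: "0 < \<epsilon>" "\<And>s. \<bar>s\<bar> < \<epsilon> \<Longrightarrow> r + s \<in> B"
    using AB(2,4) by (force simp: open_dist dist_real_def)
  define N where "N = {v. \<forall>x\<in>I. \<bar>pairing v x\<bar> < e x}"
  have "convex N"
  proof -
    have "N = (\<Inter>x\<in>I. (\<lambda>v. pairing v x) -` {- e x<..<e x})"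
    proof -
      have "\<bar>s\<bar> < k \<longleftrightarrow> s \<in> {- k<..<k}" for s k :: real
        by auto
      then show ?thesis
        unfolding N_def by blast
    qed
    moreover have "linear (\<lambda>v. pairing v x)" for x :: 'x
      by (rule linearI) (simp_all add: plus_dual.rep_eq scaleR_dual.rep_eq)
    ultimately show ?thesis
      by (auto intro!: convex_INT convex_linear_vimage)
  qed
  moreover have "absorbing N"
    unfolding absorbing_def N_def mem_Collect_eq
  proof (intro allI eventually_ball_finite[OF I] ballI)
    fix v :: "'x dual" and x
    have "((\<lambda>t. \<bar>t * pairing v x\<bar>) \<longlongrightarrow> \<bar>0 * pairing v x\<bar>) (at_right 0)"
      by (intro tendsto_intros)
    then show "\<forall>\<^sub>F t in at_right 0. \<bar>pairing (t *\<^sub>R v) x\<bar> < e x"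
      using e by (auto simp: scaleR_dual.rep_eq dest: order_tendstoD)
  qed
  moreover have "absorbing {- \<epsilon><..<\<epsilon>}"
    unfolding absorbing_def
  proof
    fix x :: real
    have "((\<lambda>t. t *\<^sub>R x) \<longlongrightarrow> 0 *\<^sub>R x) (at_right 0)"
      by (intro tendsto_intros)
    then show "\<forall>\<^sub>F t in at_right 0. t *\<^sub>R x \<in> {- \<epsilon><..<\<epsilon>}"
      using \<epsilon> by (auto dest: topological_tendstoD[of _ _ _ "{- \<epsilon><..<\<epsilon>}"])
  qed
  ultimately have V: "convex (N \<times> {- \<epsilon><..<\<epsilon>})" "absorbing (N \<times> {- \<epsilon><..<\<epsilon>})"
    by (auto intro!: convex_Times absorbing_Times)
  have sym: "- v \<in> N \<times> {- \<epsilon><..<\<epsilon>}" if "v \<in> N \<times> {- \<epsilon><..<\<epsilon>}" for v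
    using that by (cases v) (auto simp: N_def uminus_dual.rep_eq)
  have disj: "(y, r) + v \<notin> C" if v: "v \<in> N \<times> {- \<epsilon><..<\<epsilon>}" for v
  proof -
    obtain w s where ws: "v = (w, s)" by (cases v)
    have "y + w \<in> A" "r + s \<in> B"
      using v unfolding ws N_def by (auto intro!: A \<epsilon>(2))
    then show ?thesis using AB(5) ws by auto
  qed
  obtain f :: "'x dual \<times> real \<Rightarrow> real" and \<delta> where f: "linear f"
    "\<And>v. v \<in> N \<times> {- \<epsilon><..<\<epsilon>} \<Longrightarrow> \<bar>f v\<bar> \<le> 1"
    and \<delta>: "0 < \<delta>" "\<And>x. x \<in> C \<Longrightarrow> f x + \<delta> \<le> f (y, r)"
    using convex_separation[OF C(2,3) V sym disj] by blast
  have lin: "linear (\<lambda>v. f (v, 0))"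
    using linear_compose[of "\<lambda>v. (v, 0)" f] f(1) by (auto simp: linear_iff o_def)
  have kernel: "f (v, 0) = 0" if v: "\<And>x. x \<in> I \<Longrightarrow> pairing v x = 0" for v
  proof (rule ccontr)
    assume nz: "f (v, 0) \<noteq> 0"
    \<comment> \<open>All multiples of \<open>v\<close> stay in \<open>N\<close>; this one has value
      2, above the bound 1.\<close>
    define t where "t = 2 / f (v, 0)"
    have "\<bar>f (t *\<^sub>R v, 0)\<bar> \<le> 1"
      using v e \<epsilon>(1) by (intro f(2)) (auto simp: N_def scaleR_dual.rep_eq)
    moreover have "f (t *\<^sub>R v, 0) = 2"
      using nz linear_scale[OF lin, of t v] by (simp add: t_def)
    ultimately show False by simp
  qed
  obtain \<alpha> where \<alpha>: "\<And>v. f (v, 0) = (\<Sum>x\<in>I. \<alpha> x * pairing v x)"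
    by (rule linear_combination_of_common_kernel[OF I lin, of "\<lambda>x v. pairing v x"])
      (auto intro!: linearI kernel simp: plus_dual.rep_eq scaleR_dual.rep_eq)
  \<comment> \<open>The combination of evaluations collapses to evaluation at a single vector, and
    \<open>f (0, 1)\<close> is the coefficient \<open>b\<close> of the real component.\<close>
  have f_eq: "f (v, s) = pairing v (\<Sum>x\<in>I. \<alpha> x *\<^sub>R x) + f (0, 1) * s" for v s
  proof -
    have "f (v, s) = f (v, 0) + f (s *\<^sub>R (0, 1))"
      using linear_add[OF f(1), of "(v, 0)" "(0, s)"] by simp
    then show ?thesis
      by (simp add: linear_scale[OF f(1)] \<alpha> pairing_sum_scaleR del: scaleR_Pair)
  qed
  show thesis
  proof (rule that[OF \<delta>(1)])
    fix y' r' assume "(y', r') \<in> C"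
    from \<delta>(2)[OF this] show "pairing y' (\<Sum>x\<in>I. \<alpha> x *\<^sub>R x) + f (0, 1) * r' + \<delta>
        \<le> pairing y (\<Sum>x\<in>I. \<alpha> x *\<^sub>R x) + f (0, 1) * r"
      unfolding f_eq[of y' r'] f_eq[of y r] .
  qed
qed

section \<open>The moment set and the feasible set\<close>

text \<open>Outside the domain the scalarization is infinite and the term of the supremum is minus
  infinity, so only real inequalities remain.\<close>

lemma mem_epi_conjugate_scalarization:
  "(y, r) \<in> epi (conjugate (scalarization l G)) \<longleftrightarrow>
    (\<forall>x z. G x = Some z \<longrightarrow> pairing y x - pairing l z \<le> r)"
proof -
  have "ereal (pairing y x) - scalarization l G x \<le> ereal r \<longleftrightarrow>
      (\<forall>z. G x = Some z \<longrightarrow> pairing y x - pairing l z \<le> r)" for x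
    by (cases "G x") (auto simp: scalarization_def)
  then show ?thesis
    by (auto simp: epi_def conjugate_def SUP_le_iff)
qed

lemma mem_robust_moment_set:
  "(y, r) \<in> robust_moment_set S U G \<longleftrightarrow>
    (\<exists>u\<in>U. \<exists>l\<in>dual_cone S. \<forall>x z. G u x = Some z \<longrightarrow> pairing y x - pairing l z \<le> r)"
  by (auto simp: robust_moment_set_def mem_epi_conjugate_scalarization)

lemma le_dual_objective:
  "ereal r \<le> dual_objective G c u l \<longleftrightarrow>
    (\<forall>x z. G u x = Some z \<longrightarrow> r \<le> pairing c x + pairing l z)"
proof -
  have "ereal r \<le> ereal (pairing c x) + scalarization l (G u) x \<longleftrightarrow>
      (\<forall>z. G u x = Some z \<longrightarrow> r \<le> pairing c x + pairing l z)" for x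
    by (cases "G u x") (auto simp: scalarization_def)
  then show ?thesis
    by (auto simp: dual_objective_def le_INF_iff)
qed

text \<open>The dictionary between duality and the moment set: the dual objective at
  \<open>c\<close> is minus the conjugate at \<open>- c\<close>, whence both signs change.\<close>

lemma dual_objective_mem_moment_set:
  "(\<exists>u\<in>U. \<exists>l\<in>dual_cone S. ereal r \<le> dual_objective G c u l) \<longleftrightarrow>
    (- c, - r) \<in> robust_moment_set S U G"
proof -
  have "r \<le> s + t \<longleftrightarrow> - s - t \<le> - r" for s t :: real
    by linarith
  then show ?thesis
    by (simp only: le_dual_objective mem_robust_moment_set uminus_dual.rep_eq)
qed

lemma feasible_obtains:
  assumes "x \<in> feasible_set S U G" "u \<in> U" "l \<in> dual_cone S"
  obtains z where "G u x = Some z" "pairing l z \<le> 0"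
proof -
  obtain s where "s \<in> S" "G u x = Some (- s)"
    using assms by (auto simp: feasible_set_def)
  then show thesis
    using assms(3) that[of "- s"] linear_neg[OF linear_pairing[of l], of s]
    by (auto simp: dual_cone_def)
qed

text \<open>Weak duality: at a feasible point the scalarization is at most 0.\<close>

lemma dual_objective_le_inf_RP:
  assumes "u \<in> U" "l \<in> dual_cone S"
  shows "dual_objective G c u l \<le> inf_RP S U G c"
  unfolding inf_RP_def
proof (rule INF_greatest)
  fix x assume "x \<in> feasible_set S U G"
  then obtain z where z: "G u x = Some z" "pairing l z \<le> 0"
    by (rule feasible_obtains[OF _ assms])
  have "dual_objective G c u l \<le> ereal (pairing c x) + scalarization l (G u) x"
    unfolding dual_objective_def by (rule INF_lower) simp
  also have "\<dots> \<le> ereal (pairing c x)"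
    using z by (simp add: scalarization_def)
  finally show "dual_objective G c u l \<le> ereal (pairing c x)" .
qed

lemma sup_RD_le_inf_RP: "sup_RD S U G c \<le> inf_RP S U G c"
  unfolding sup_RD_def by (auto intro!: SUP_least dual_objective_le_inf_RP)

lemma dual_objective_le_sup_RD:
  assumes "u \<in> U" "l \<in> dual_cone S"
  shows "dual_objective G c u l \<le> sup_RD S U G c"
  unfolding sup_RD_def using assms by (intro SUP_upper2[of "(u, l)"]) auto

lemma le_inf_RP: "ereal r \<le> inf_RP S U G c \<longleftrightarrow> (\<forall>x\<in>feasible_set S U G. r \<le> pairing c x)"
  by (simp add: inf_RP_def le_INF_iff)

lemma zero_mem_dual_cone: "0 \<in> dual_cone S"
  by (simp add: dual_cone_def zero_dual.rep_eq)

text \<open>Weak duality supplies the reverse inequalities, so a single dual pair reaching the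
  primal value yields equality and attainment together.\<close>

lemma robust_strong_duality_iff:
  assumes "U \<noteq> {}"
  shows "robust_strong_duality S U G c \<longleftrightarrow>
    (\<exists>u\<in>U. \<exists>l\<in>dual_cone S. inf_RP S U G c \<le> dual_objective G c u l)"
proof
  show "robust_strong_duality S U G c \<Longrightarrow>
      \<exists>u\<in>U. \<exists>l\<in>dual_cone S. inf_RP S U G c \<le> dual_objective G c u l"
    unfolding robust_strong_duality_def by (metis order_refl)
  assume "\<exists>u\<in>U. \<exists>l\<in>dual_cone S. inf_RP S U G c \<le> dual_objective G c u l"
  then obtain u l where ul: "u \<in> U" "l \<in> dual_cone S" "inf_RP S U G c \<le> dual_objective G c u l"
    by blast
  then have "inf_RP S U G c = sup_RD S U G c" "dual_objective G c u l = sup_RD S U G c"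
    using dual_objective_le_sup_RD[OF ul(1,2), of G c] sup_RD_le_inf_RP[of S U G c] by auto
  then show "robust_strong_duality S U G c"
    using ul by (auto simp: robust_strong_duality_def)
qed

section \<open>The support epigraph and the reformulation of stable duality\<close>

definition support_epi :: "'x::{real_vector, topological_space} set \<Rightarrow> ('x dual \<times> real) set"
  where "support_epi F = {(y, r). \<forall>x\<in>F. pairing y x \<le> r}"

lemma closed_support_epi: "closed (support_epi F)"
proof -
  have "continuous_on UNIV (\<lambda>p. pairing (fst p) x)" for x :: 'a
    by (rule continuous_on_compose2[OF continuous_on_pairing_eval]) (auto intro: continuous_intros)
  then have "closed {p. pairing (fst p) x \<le> (snd p :: real)}" for x :: 'a
    by (intro closed_Collect_le continuous_intros)
  then have "closed (\<Inter>x\<in>F. {p. pairing (fst p) x \<le> snd p})"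
    by blast
  also have "(\<Inter>x\<in>F. {p. pairing (fst p) x \<le> snd p}) = support_epi F"
    by (auto simp: support_epi_def)
  finally show ?thesis .
qed

lemma convex_support_epi: "convex (support_epi F)"
  unfolding convex_def support_epi_def
  by (auto simp: plus_dual.rep_eq scaleR_dual.rep_eq intro!: add_mono mult_left_mono)

text \<open>Weak duality in epigraph form: at a feasible \<open>x\<close> the subtracted term
  \<open>pairing l z\<close> is at most 0.\<close>

lemma moment_set_subset_support_epi:
  "robust_moment_set S U G \<subseteq> support_epi (feasible_set S U G)"
proof clarify
  fix y r assume "(y, r) \<in> robust_moment_set S U G"
  then obtain u l where "u \<in> U" "l \<in> dual_cone S"
    and *: "\<And>x z. G u x = Some z \<Longrightarrow> pairing y x - pairing l z \<le> r"
    by (auto simp: mem_robust_moment_set)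
  then show "(y, r) \<in> support_epi (feasible_set S U G)"
    unfolding support_epi_def by (fastforce elim!: feasible_obtains dest!: *)
qed

text \<open>\<open>(y, r)\<close> is in the support epigraph exactly when \<open>- r\<close> is a
  lower bound of the primal problem for \<open>c = - y\<close>. Strong duality at that
  \<open>c\<close> puts all such points into the moment set.\<close>

lemma stable_robust_strong_duality_iff:
  assumes U: "U \<noteq> {}" and F: "feasible_set S U G \<noteq> {}"
  shows "(\<forall>c. robust_strong_duality S U G c) \<longleftrightarrow>
    robust_moment_set S U G = support_epi (feasible_set S U G)"
proof
  assume dual: "\<forall>c. robust_strong_duality S U G c"
  have "(y, r) \<in> robust_moment_set S U G" if "(y, r) \<in> support_epi (feasible_set S U G)" for y r
  proof -
    have "ereal (- r) \<le> inf_RP S U G (- y)"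
      using that unfolding le_inf_RP by (auto simp: support_epi_def uminus_dual.rep_eq)
    then have "(- (- y), - (- r)) \<in> robust_moment_set S U G"
      using dual unfolding dual_objective_mem_moment_set[symmetric] robust_strong_duality_iff[OF U]
      by (meson order_trans)
    then show ?thesis by simp
  qed
  then show "robust_moment_set S U G = support_epi (feasible_set S U G)"
    using moment_set_subset_support_epi by fastforce
next
  assume eq: "robust_moment_set S U G = support_epi (feasible_set S U G)"
  show "\<forall>c. robust_strong_duality S U G c"
    unfolding robust_strong_duality_iff[OF U]
  proof
    fix c
    show "\<exists>u\<in>U. \<exists>l\<in>dual_cone S. inf_RP S U G c \<le> dual_objective G c u l"
    proof (cases "inf_RP S U G c")
      case (real r)
      then have "(- c, - r) \<in> support_epi (feasible_set S U G)"
        using le_inf_RP[of r S U G c] by (auto simp: support_epi_def uminus_dual.rep_eq)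
      then show ?thesis
        using real dual_objective_mem_moment_set[of U S r G c] eq by simp
    next
      case PInf
      \<comment> \<open>A feasible point rules this case out.\<close>
      obtain x where "x \<in> feasible_set S U G" using F by blast
      then have "inf_RP S U G c \<le> ereal (pairing c x)"
        unfolding inf_RP_def by (rule INF_lower)
      then show ?thesis using PInf by simp
    next
      case MInf
      \<comment> \<open>Every dual pair reaches the value minus infinity; the multiplier 0 with any
        \<open>u\<close> will do.\<close>
      then show ?thesis using U zero_mem_dual_cone by fastforce
    qed
  qed
qed

section \<open>Conic structure of the moment set and recovery of the feasible set\<close>

lemma scaleR_mem_moment_set:
  assumes "(y, r) \<in> robust_moment_set S U G" "0 \<le> t"
  shows "(t *\<^sub>R y, t * r) \<in> robust_moment_set S U G"
proof -
  obtain u l where ul: "u \<in> U" "l \<in> dual_cone S"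
    and *: "\<And>x z. G u x = Some z \<Longrightarrow> pairing y x - pairing l z \<le> r"
    using assms(1) by (auto simp: mem_robust_moment_set)
  \<comment> \<open>The multiplier is scaled along with the point, and the same \<open>u\<close>
    serves.\<close>
  have "t *\<^sub>R l \<in> dual_cone S"
    using ul(2) assms(2) by (auto simp: dual_cone_def scaleR_dual.rep_eq)
  moreover have "pairing (t *\<^sub>R y) x - pairing (t *\<^sub>R l) z \<le> t * r" if "G u x = Some z" for x z
    using mult_left_mono[OF *[OF that] assms(2)]
    by (simp add: scaleR_dual.rep_eq right_diff_distrib)
  ultimately show ?thesis
    using ul(1) by (auto simp: mem_robust_moment_set)
qed

lemma zero_mem_moment_set:
  assumes "U \<noteq> {}"
  shows "(0, 0) \<in> robust_moment_set S U G"
proof -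
  obtain u where "u \<in> U" using assms by blast
  then show ?thesis
    unfolding mem_robust_moment_set
    by (intro bexI[of _ u] bexI[OF _ zero_mem_dual_cone]) (simp_all add: zero_dual.rep_eq)
qed

lemma upward_mem_moment_set:
  "(y, r) \<in> robust_moment_set S U G \<Longrightarrow> r \<le> r' \<Longrightarrow> (y, r') \<in> robust_moment_set S U G"
  unfolding mem_robust_moment_set by (meson order_trans)

text \<open>Feasibility at \<open>u\<close> means that \<open>(a, 0)\<close> lies in the epigraph of
  \<open>G u\<close>. Otherwise a separating pair \<open>(y, l)\<close> has \<open>- l\<close> in
  the dual cone, and \<open>(y, pairing y a - \<delta>)\<close> is a point of the moment set
  violating the bound at \<open>a\<close>.\<close>

lemma mem_feasible_set_if_moment_le:
  fixes S :: "'z::locally_convex_t2_space set"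
    and G :: "'u \<Rightarrow> 'x::locally_convex_t2_space \<Rightarrow> 'z option"
  assumes S: "S \<noteq> {}" "cone S"
    and G: "\<And>u. u \<in> U \<Longrightarrow> proper_mapping (G u)"
      "\<And>u. u \<in> U \<Longrightarrow> cone_convex S (G u)"
      "\<And>u. u \<in> U \<Longrightarrow> cone_epi_closed S (G u)"
    and le: "\<And>y r. (y, r) \<in> robust_moment_set S U G \<Longrightarrow> pairing y a \<le> r"
  shows "a \<in> feasible_set S U G"
  unfolding feasible_set_def mem_Collect_eq
proof
  fix u assume u: "u \<in> U"
  have epi: "(x, z + t *\<^sub>R s) \<in> cone_epi S (G u)" if "G u x = Some z" "s \<in> S" "0 \<le> t" for x z s t
    using that S(2) by (auto simp: cone_epi_def cone_def)
  obtain x\<^sub>0 z\<^sub>0 where xz: "G u x\<^sub>0 = Some z\<^sub>0"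
    using G(1)[OF u] by (auto simp: proper_mapping_def dom_def)
  have "(a, 0) \<in> cone_epi S (G u)"
  proof (rule ccontr)
    assume "(a, 0) \<notin> cone_epi S (G u)"
    moreover have "cone_epi S (G u) \<noteq> {}"
      using epi[OF xz _ order_refl] S(1) by blast
    ultimately obtain y l \<delta> where \<delta>: "0 < \<delta>" and
      sep: "\<And>x z. (x, z) \<in> cone_epi S (G u) \<Longrightarrow>
        pairing y x + pairing l z + \<delta> \<le> pairing y a + pairing l 0"
      using separation_Times G(2,3)[OF u] unfolding cone_convex_def cone_epi_closed_def by metis
    have l0: "pairing l 0 = 0"
      using linear_0[OF linear_pairing] .
    have "pairing l s \<le> 0" if s: "s \<in> S" for s
    proof (rule ccontr)
      assume "\<not> pairing l s \<le> 0"
      then have pos: "0 < pairing l s" by simp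
      \<comment> \<open>Chosen so that \<open>t * pairing l s\<close> makes up the whole difference
        to \<open>pairing y a\<close>, leaving no room for \<open>\<delta>\<close>.\<close>
      define t where "t = \<bar>pairing y a - pairing y x\<^sub>0 - pairing l z\<^sub>0\<bar> / pairing l s"
      have "0 \<le> t" using pos by (simp add: t_def)
      then have "pairing y x\<^sub>0 + (pairing l z\<^sub>0 + t * pairing l s) + \<delta> \<le> pairing y a"
        using sep[OF epi[OF xz s]] l0
        by (simp add: linear_add[OF linear_pairing] linear_scale[OF linear_pairing])
      then show False
        using \<delta> pos by (simp add: t_def)
    qed
    then have "- l \<in> dual_cone S"
      by (auto simp: dual_cone_def uminus_dual.rep_eq)
    moreover have "pairing y x - pairing (- l) z \<le> pairing y a - \<delta>" if "G u x = Some z" for x z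
    proof -
      \<comment> \<open>Any \<open>s\<close> with coefficient 0 puts \<open>(x, z)\<close> itself
        into the epigraph.\<close>
      obtain s where "s \<in> S" using S(1) by blast
      then show ?thesis
        using sep[OF epi[OF that _ order_refl]] l0 by (simp add: uminus_dual.rep_eq algebra_simps)
    qed
    ultimately have "(y, pairing y a - \<delta>) \<in> robust_moment_set S U G"
      using u unfolding mem_robust_moment_set by blast
    from le[OF this] show False
      using \<delta> by simp
  qed
  then obtain z s where zs: "G u a = Some z" "s \<in> S" "0 = z + s"
    by (auto simp: cone_epi_def)
  then have "z = - s"
    by (simp add: eq_neg_iff_add_eq_0)
  then show "G u a \<in> Some ` uminus ` S"
    using zs by blast
qed

lemma support_epi_subset_moment_set:
  fixes S :: "'z::locally_convex_t2_space set"
    and G :: "'u \<Rightarrow> 'x::locally_convex_t2_space \<Rightarrow> 'z option"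
  assumes S: "S \<noteq> {}" "cone S"
    and U: "U \<noteq> {}"
    and G: "\<And>u. u \<in> U \<Longrightarrow> proper_mapping (G u)"
      "\<And>u. u \<in> U \<Longrightarrow> cone_convex S (G u)"
      "\<And>u. u \<in> U \<Longrightarrow> cone_epi_closed S (G u)"
    and F: "feasible_set S U G \<noteq> {}"
    and M: "closed (robust_moment_set S U G)" "convex (robust_moment_set S U G)"
  shows "support_epi (feasible_set S U G) \<subseteq> robust_moment_set S U G"
proof clarify
  let ?F = "feasible_set S U G" and ?M = "robust_moment_set S U G"
  fix y r assume yr: "(y, r) \<in> support_epi ?F"
  then have y: "pairing y x \<le> r" if "x \<in> ?F" for x
    using that by (simp add: support_epi_def)
  note feasibleI = mem_feasible_set_if_moment_le[where U = U and S = S and G = G, OF S G]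
  have M_le: "pairing y' x \<le> r'" if "(y', r') \<in> ?M" "x \<in> ?F" for y' r' x
    using that moment_set_subset_support_epi[of S U G] by (auto simp: support_epi_def)
  show "(y, r) \<in> ?M"
  proof (rule ccontr)
    assume notin: "(y, r) \<notin> ?M"
    have ne: "?M \<noteq> {}"
      using zero_mem_moment_set[OF U, of S G] by blast
    obtain x b \<delta> where \<delta>: "0 < \<delta>"
      and sep: "\<And>y' r'. (y', r') \<in> ?M \<Longrightarrow> pairing y' x + b * r' + \<delta> \<le> pairing y x + b * r"
      by (rule weak_star_separation[OF M ne notin]) (erule that, blast)
    have pos: "0 < pairing y x + b * r"
      using sep[OF zero_mem_moment_set[OF U]] \<delta> by (simp add: zero_dual.rep_eq)
    have cone: "pairing y' x + b * r' \<le> 0" if "(y', r') \<in> ?M" for y' r'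
    proof (rule ccontr)
      assume "\<not> pairing y' x + b * r' \<le> 0"
      then have p: "0 < pairing y' x + b * r'" by simp
      \<comment> \<open>Rescales the value at \<open>(y', r')\<close> to exactly that at
        \<open>(y, r)\<close>, which contradicts the gap \<open>\<delta>\<close>.\<close>
      define t where "t = (pairing y x + b * r) / (pairing y' x + b * r')"
      have "0 \<le> t" using p pos by (simp add: t_def)
      from sep[OF scaleR_mem_moment_set[OF that this]]
      have "t * (pairing y' x + b * r') + \<delta> \<le> pairing y x + b * r"
        by (simp add: scaleR_dual.rep_eq algebra_simps)
      then show False using p \<delta> by (simp add: t_def)
    qed
    \<comment> \<open>Tested at \<open>(0, 1)\<close>, which lies above the origin of the
      cone.\<close>
    have "b \<le> 0"
      using cone[OF upward_mem_moment_set[OF zero_mem_moment_set[OF U], of 1]]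
      by (simp add: zero_dual.rep_eq)
    then consider "b < 0" | "b = 0" by linarith
    then show False
    proof cases
      case 1
      \<comment> \<open>Division by \<open>- b\<close> normalizes the coefficient of
        \<open>r'\<close> to \<open>-1\<close>, so \<open>cone\<close> becomes the feasibility
        criterion and \<open>pos\<close> its violation at \<open>(y, r)\<close>.\<close>
      have scale: "pairing y' (x /\<^sub>R (- b)) = - pairing y' x / b" for y'
        using linear_scale[OF linear_pairing, of y' "inverse (- b)" x] by (simp add: divide_inverse)
      have "x /\<^sub>R (- b) \<in> ?F"
      proof (rule feasibleI)
        fix y' r' assume "(y', r') \<in> ?M"
        then show "pairing y' (x /\<^sub>R (- b)) \<le> r'"
          using cone[of y' r'] 1 unfolding scale by (simp add: field_simps)
      qed
      from y[OF this] show False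
        using pos 1 unfolding scale by (simp add: field_simps)
    next
      case 2
      obtain x\<^sub>0 where x0: "x\<^sub>0 \<in> ?F" using F by blast
      \<comment> \<open>Here \<open>pairing y x > 0\<close>, and this step along \<open>x\<close>
        raises the value at \<open>x\<^sub>0\<close> to at least \<open>r + 1\<close>.\<close>
      define t where "t = (\<bar>r - pairing y x\<^sub>0\<bar> + 1) / pairing y x"
      have t: "0 \<le> t" using pos 2 by (simp add: t_def)
      have "x\<^sub>0 + t *\<^sub>R x \<in> ?F"
      proof (rule feasibleI)
        fix y' r' assume M: "(y', r') \<in> ?M"
        have "t * pairing y' x \<le> 0"
          using cone[OF M] 2 t by (simp add: mult_nonneg_nonpos)
        then show "pairing y' (x\<^sub>0 + t *\<^sub>R x) \<le> r'"
          using M_le[OF M x0] by (simp add: linear_add[OF linear_pairing] linear_scale[OF linear_pairing])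
      qed
      from y[OF this] show False
        using pos 2 by (simp add: linear_add[OF linear_pairing] linear_scale[OF linear_pairing] t_def)
    qed
  qed
qed

theorem theorem2p1:
  fixes S :: "'z::locally_convex_t2_space set"
    and U :: "'u set"
    and G :: "'u \<Rightarrow> 'x::locally_convex_t2_space \<Rightarrow> 'z option"
    and c\<^sub>0 :: "'x dual"
  assumes S: "S \<noteq> {}" "closed S" "convex S" "cone S"
    and U: "U \<noteq> {}"
    and G: "\<And>u. u \<in> U \<Longrightarrow> proper_mapping (G u)"
      "\<And>u. u \<in> U \<Longrightarrow> cone_convex S (G u)"
      "\<And>u. u \<in> U \<Longrightarrow> cone_epi_closed S (G u)"
    and feasible: "feasible_set S U G \<noteq> {}"
    and bounded_below: "inf_RP S U G c\<^sub>0 > -\<infinity>"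
  shows "closed (robust_moment_set S U G) \<and> convex (robust_moment_set S U G)
    \<longleftrightarrow> (\<forall>c. robust_strong_duality S U G c)"
proof -
  have "robust_moment_set S U G = support_epi (feasible_set S U G)"
    if "closed (robust_moment_set S U G)" "convex (robust_moment_set S U G)"
    using moment_set_subset_support_epi[of S U G]
      support_epi_subset_moment_set[OF S(1,4) U G feasible that] by blast
  \<comment> \<open>For the other direction, the equality transports closedness and convexity from
    the support epigraph to the moment set.\<close>
  then show ?thesis
    unfolding stable_robust_strong_duality_iff[OF U feasible]
    using closed_support_epi convex_support_epi by metis
qed

end
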